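(* Let $\mathbb F$ be a field of characteristic zero, let $a\in\mathbb F$, and let $\mathcal W$ be the $\mathbb F$-vector space with basis $\{L_i, I_j\}_{i,j\in\mathbb Z}$. Fix $w\in\mathcal W$ and let $(\mathcal W,\cdot,[\,,])$ be the transposed Poisson algebra whose nonzero products of basis elements are determined (up to commutativity of $\cdot$ and anticommutativity of $[\,,]$) by $$[L_m,L_n]=(m-n)L_{m+n},\qquad [L_m,I_n]=(m-n-a)I_{m+n},$$ $$L_m\cdot L_n=wL_{m+n},\qquad L_m\cdot I_n=wI_{m+n},$$ where juxtaposition denotes the commutative bilinear multiplication on $\mathcal W$ with $L_iL_j=L_{i+j}$, $L_iI_j=I_{i+j}$, $I_iI_j=0$. Fix $u\in\mathcal W$ and let $\star=\llbracket [\,,],\cdot\rrbracket$ and $\{\,,\}=\llbracket\cdot,[\,,]\rrbracket$ be the Kantor products with respect to $u$. Then $(\mathcal W,\star,\{\,,\})$ is a transposed Poisson algebra.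
   Context: For bilinear multiplications $P,Q$ on a vector space $V$ and a fixed $u\in V$, the Kantor product $\llbracket P,Q\rrbracket$ (with respect to $u$) is the bilinear multiplication $\llbracket P,Q\rrbracket(x,y)=P(u,Q(x,y))-Q(P(u,x),y)-Q(x,P(u,y))$. A transposed Poisson algebra $(A,\cdot,[\,,])$ is a vector space with two bilinear operations such that $(A,\cdot)$ is an associative commutative algebra, $(A,[\,,])$ is a Lie algebra, and $2z\cdot[x,y]=[z\cdot x,y]+[x,z\cdot y]$ for all $x,y,z\in A$. *)

theory Defs
  imports Complex_Main
begin

context vector_space
begin

definition basis_family :: "('i \<Rightarrow> 'b) \<Rightarrow> bool" where
  "basis_family b \<longleftrightarrow> inj b \<and> independent (range b) \<and> span (range b) = UNIV"

definition bilinear_mult :: "('b \<Rightarrow> 'b \<Rightarrow> 'b) \<Rightarrow> bool" where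
  "bilinear_mult f \<longleftrightarrow>
     (\<forall>x. Vector_Spaces.linear scale scale (\<lambda>y. f x y)) \<and>
     (\<forall>y. Vector_Spaces.linear scale scale (\<lambda>x. f x y))"

end

locale comm_assoc_algebra = vector_space scale
  for scale :: "'f::field \<Rightarrow> 'v::ab_group_add \<Rightarrow> 'v" +
  fixes mul :: "'v \<Rightarrow> 'v \<Rightarrow> 'v"
  assumes mul_bilinear: "bilinear_mult mul"
    and mul_assoc: "mul (mul x y) z = mul x (mul y z)"
    and mul_commute: "mul x y = mul y x"

locale lie_algebra = vector_space scale
  for scale :: "'f::field \<Rightarrow> 'v::ab_group_add \<Rightarrow> 'v" +
  fixes br :: "'v \<Rightarrow> 'v \<Rightarrow> 'v"
  assumes br_bilinear: "bilinear_mult br"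
    and br_alternating: "br x x = 0"
    and br_jacobi: "br x (br y z) + br y (br z x) + br z (br x y) = 0"

locale transposed_poisson_algebra =
  comm_assoc_algebra scale mul + lie_algebra scale br
  for scale :: "'f::field \<Rightarrow> 'v::ab_group_add \<Rightarrow> 'v"
    and mul :: "'v \<Rightarrow> 'v \<Rightarrow> 'v"
    and br :: "'v \<Rightarrow> 'v \<Rightarrow> 'v" +
  assumes transposed_leibniz:
    "scale 2 (mul z (br x y)) = br (mul z x) y + br x (mul z y)"

definition kantor_product ::
    "'v \<Rightarrow> ('v \<Rightarrow> 'v \<Rightarrow> 'v) \<Rightarrow> ('v \<Rightarrow> 'v \<Rightarrow> 'v) \<Rightarrow> 'v \<Rightarrow> 'v \<Rightarrow> 'v::ab_group_add" where
  "kantor_product u P Q x y = P u (Q x y) - Q (P u x) y - Q x (P u y)"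

end

theory Submission
  imports Defs
begin

text \<open>
  Write \<open>x y\<close> for the juxtaposition product and put \<open>D x = [x, L\<^sub>0]\<close>, so that
  \<open>D L\<^sub>m = m L\<^sub>m\<close> and \<open>D I\<^sub>n = (n + a) I\<^sub>n\<close>. Juxtaposition makes the space a commutative
  associative algebra (Laurent polynomials over the dual numbers), \<open>D\<close> is a derivation of it, and
  comparison on the basis shows that the given operations are
  \<open>x \<cdot> y = w x y\<close> and \<open>[x, y] = (D x) y - x (D y)\<close>.

  For every commutative associative algebra with a derivation \<open>D\<close> and every element \<open>w\<close>, these two
  formulas define a transposed Poisson algebra (\<open>wronskian_transposed_poisson\<close>). Moreover this
  family of structures is closed under the Kantor products: expanding with the Leibniz rule gives
  \<open>x \<star> y = - D (u w) x y\<close> (\<open>kantor_wronskian_twisted\<close>) and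
  \<open>{x, y} = - u w ((D x) y - x (D y))\<close> (\<open>kantor_twisted_wronskian\<close>). The latter is again a
  Wronskian bracket, for the derivation \<open>- u w D\<close>, so the pair of Kantor products has the
  same form as the original pair, with another element and another derivation.
\<close>

section \<open>Linear and bilinear maps\<close>

context vector_space
begin

lemma bilinear_multI:
  assumes "\<And>x y z. f x (y + z) = f x y + f x z" and "\<And>x y z. f (x + y) z = f x z + f y z"
    and "\<And>c x y. f x (scale c y) = scale c (f x y)" and "\<And>c x y. f (scale c x) y = scale c (f x y)"
  shows "bilinear_mult f"
  by (simp add: bilinear_mult_def Vector_Spaces.linear_iff vector_space_axioms assms)

context
  fixes f
  assumes f: "bilinear_mult f"
begin

lemma bilinear_linear_right: "Vector_Spaces.linear scale scale (\<lambda>y. f x y)"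
  and bilinear_linear_left: "Vector_Spaces.linear scale scale (\<lambda>x. f x y)"
  using f by (auto simp: bilinear_mult_def)

lemmas bilinear_simps =
  module_hom.add[OF module_hom_linearI[OF bilinear_linear_right]]
  module_hom.add[OF module_hom_linearI[OF bilinear_linear_left]]
  module_hom.diff[OF module_hom_linearI[OF bilinear_linear_right]]
  module_hom.diff[OF module_hom_linearI[OF bilinear_linear_left]]
  module_hom.neg[OF module_hom_linearI[OF bilinear_linear_right]]
  module_hom.neg[OF module_hom_linearI[OF bilinear_linear_left]]
  module_hom.scale[OF module_hom_linearI[OF bilinear_linear_right]]
  module_hom.scale[OF module_hom_linearI[OF bilinear_linear_left]]
  module_hom.zero[OF module_hom_linearI[OF bilinear_linear_right]]
  module_hom.zero[OF module_hom_linearI[OF bilinear_linear_left]]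

end

lemma basis_induct [consumes 1, case_names zero add scale left right]:
  assumes basis: "basis_family (case_sum L I)"
    and "P 0" and "\<And>x y. P x \<Longrightarrow> P y \<Longrightarrow> P (x + y)" and "\<And>c x. P x \<Longrightarrow> P (scale c x)"
    and "\<And>i. P (L i)" and "\<And>i. P (I i)"
  shows "P x"
proof -
  have "x \<in> span (range (case_sum L I))"
    using basis by (simp add: basis_family_def)
  then show ?thesis
  proof (induction rule: span_induct)
    case base
    show ?case using assms(2-4) by (auto simp: subspace_def)
  next
    case (step x)
    then obtain s where "x = case_sum L I s" by blast
    then show ?case using assms(5,6) by (cases s) auto
  qed
qed

end

section \<open>Commutative algebras with a derivation\<close>

locale differential_algebra = comm_assoc_algebra scale mul
  for scale :: "'f::field \<Rightarrow> 'v::ab_group_add \<Rightarrow> 'v" and mul :: "'v \<Rightarrow> 'v \<Rightarrow> 'v" (infixl \<open>\<odot>\<close> 70) +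
  fixes D :: "'v \<Rightarrow> 'v"
  assumes D_linear: "Vector_Spaces.linear scale scale D"
    and leibniz: "D (x \<odot> y) = D x \<odot> y + x \<odot> D y"
begin

abbreviation twisted :: "'v \<Rightarrow> 'v \<Rightarrow> 'v \<Rightarrow> 'v" where
  "twisted w x y \<equiv> w \<odot> (x \<odot> y)"

abbreviation wronskian :: "'v \<Rightarrow> 'v \<Rightarrow> 'v" where
  "wronskian x y \<equiv> D x \<odot> y - x \<odot> D y"

lemma mul_left_commute: "x \<odot> (y \<odot> z) = y \<odot> (x \<odot> z)"
  using mul_assoc mul_commute by metis

lemmas mul_ac = mul_assoc mul_commute mul_left_commute
lemmas mul_linear = bilinear_simps[OF mul_bilinear]
lemmas D_simps = module_hom.add[OF module_hom_linearI[OF D_linear]]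
  module_hom.diff[OF module_hom_linearI[OF D_linear]]
  module_hom.neg[OF module_hom_linearI[OF D_linear]]
  module_hom.scale[OF module_hom_linearI[OF D_linear]]
  leibniz

lemma differential_algebra_multiple: "differential_algebra scale mul (\<lambda>x. c \<odot> D x)"
  by unfold_locales (auto simp: D_simps mul_linear mul_ac)

text \<open>
  In \<open>[x, [y, z]]\<close> the two terms \<open>x (D y) (D z)\<close> cancel, leaving
  \<open>(D x) (D y) z - (D x) y (D z) - x (D (D y)) z + x y (D (D z))\<close>, and these cancel in pairs under
  cyclic summation. For the compatibility condition put \<open>v = w z\<close>: in \<open>[v x, y] + [x, v y]\<close> the
  element \<open>D v\<close> enters only through \<open>(D v) x y - x (D v) y = 0\<close>.
\<close>

lemma wronskian_transposed_poisson: "transposed_poisson_algebra scale (twisted w) wronskian"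
proof unfold_locales
  show "bilinear_mult (twisted w)"
    by (rule bilinear_multI) (simp_all add: mul_linear)
  show "bilinear_mult wronskian"
    by (rule bilinear_multI) (simp_all add: mul_linear D_simps scale_right_diff_distrib)
  fix x y z
  show "twisted w (twisted w x y) z = twisted w x (twisted w y z)"
    by (simp add: mul_ac)
  show "twisted w x y = twisted w y x"
    by (simp add: mul_ac)
  show "wronskian x x = 0"
    by (simp add: mul_ac)
  show "wronskian x (wronskian y z) + wronskian y (wronskian z x) + wronskian z (wronskian x y) = 0"
    by (simp add: mul_linear D_simps mul_ac algebra_simps)
  show "scale 2 (twisted w z (wronskian x y))
      = wronskian (twisted w z x) y + wronskian x (twisted w z y)"
  proof -
    have "scale 2 v = v + v" for v
      using scale_left_distrib[of 1 1 v] by simp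
    then show ?thesis
      by (simp add: mul_linear D_simps mul_ac algebra_simps)
  qed
qed

text \<open>
  The bracket \<open>[u, -]\<close> is the derivation \<open>- u D\<close> plus multiplication by \<open>D u\<close>. In the Kantor
  product the derivatives of \<open>x\<close> and \<open>y\<close> cancel, and what remains is the derivative \<open>- u (D w)\<close> of
  the coefficient together with one \<open>(D u) w\<close> minus two of them.
\<close>

lemma kantor_wronskian_twisted:
  "kantor_product u wronskian (twisted w) = twisted (- D (u \<odot> w))"
  by (intro ext) (simp add: kantor_product_def mul_linear D_simps mul_ac algebra_simps)

text \<open>
  By the compatibility condition with \<open>z = u\<close>, the last two terms of the Kantor product add up to
  \<open>- 2 u \<cdot> [x, y]\<close>, so that \<open>- u \<cdot> [x, y]\<close> remains.
\<close>

lemma kantor_twisted_wronskian: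
  "kantor_product u (twisted w) wronskian = (\<lambda>x y. (- (u \<odot> w) \<odot> D x) \<odot> y - x \<odot> (- (u \<odot> w) \<odot> D y))"
  by (intro ext) (simp add: kantor_product_def mul_linear D_simps mul_ac algebra_simps)

theorem kantor_transposed_poisson:
  "transposed_poisson_algebra scale
     (kantor_product u wronskian (twisted w)) (kantor_product u (twisted w) wronskian)"
  unfolding kantor_wronskian_twisted kantor_twisted_wronskian
  by (rule differential_algebra.wronskian_transposed_poisson[OF differential_algebra_multiple])

end

section \<open>The algebra spanned by \<open>L\<^sub>i\<close> and \<open>I\<^sub>i\<close>\<close>

theorem proposition27:
  fixes scale :: "'f::field_char_0 \<Rightarrow> 'v::ab_group_add \<Rightarrow> 'v"
    and L I :: "int \<Rightarrow> 'v"
    and a :: 'f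
    and w u :: 'v
    and juxt mul br :: "'v \<Rightarrow> 'v \<Rightarrow> 'v"
  assumes "vector_space scale"
    and "vector_space.basis_family scale (case_sum L I)"
    and "vector_space.bilinear_mult scale juxt"
    and "\<And>x y. juxt x y = juxt y x"
    and "\<And>i j. juxt (L i) (L j) = L (i + j)"
    and "\<And>i j. juxt (L i) (I j) = I (i + j)"
    and "\<And>i j. juxt (I i) (I j) = 0"
    and "transposed_poisson_algebra scale mul br"
    and "\<And>m n. br (L m) (L n) = scale (of_int (m - n)) (L (m + n))"
    and "\<And>m n. br (L m) (I n) = scale (of_int (m - n) - a) (I (m + n))"
    and "\<And>m n. br (I m) (I n) = 0"
    and "\<And>m n. mul (L m) (L n) = juxt w (L (m + n))"
    and "\<And>m n. mul (L m) (I n) = juxt w (I (m + n))"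
    and "\<And>m n. mul (I m) (I n) = 0"
  shows "transposed_poisson_algebra scale (kantor_product u br mul) (kantor_product u mul br)"
proof -
  interpret transposed_poisson_algebra scale mul br by fact
  note juxt_comm = assms(4)
  note induct = basis_induct[OF assms(2), case_names zero add scale left right]
  note juxt_linear = bilinear_simps[OF assms(3)]
  note mul_linear = bilinear_simps[OF mul_bilinear]
  note br_linear = bilinear_simps[OF br_bilinear]
  have br_anticomm: "br x y = - br y x" for x y
  proof -
    have "br x x + br y x + (br x y + br y y) = 0"
      using br_alternating[of "x + y"] by (simp add: br_linear ac_simps)
    then show ?thesis
      by (simp add: br_alternating eq_neg_iff_add_eq_0 add.commute)
  qed
  have juxt_IL: "juxt (I j) (L i) = I (j + i)" for i j
    using juxt_comm assms(6) by (metis add.commute)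
  have mul_IL: "mul (I m) (L n) = juxt w (I (m + n))" for m n
    using mul_commute assms(13) by (metis add.commute)
  have br_IL: "br (I m) (L n) = scale (of_int (m - n) + a) (I (m + n))" for m n
    using br_anticomm[of "I m" "L n"]
    by (simp add: assms(10) add.commute flip: scale_minus_left)
  note table = assms(5-7,9-14) juxt_IL mul_IL br_IL

  define D where "D x = br x (L 0)" for x
  have D_linear: "Vector_Spaces.linear scale scale D"
    unfolding D_def by (rule bilinear_linear_left[OF br_bilinear])
  have D_L: "D (L m) = scale (of_int m) (L m)" and D_I: "D (I m) = scale (of_int m + a) (I m)" for m
    by (simp_all add: D_def table)
  note D_simps = module_hom.add[OF module_hom_linearI[OF D_linear]]
    module_hom.scale[OF module_hom_linearI[OF D_linear]]
    module_hom.zero[OF module_hom_linearI[OF D_linear]]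
  note linear_simps = juxt_linear mul_linear br_linear D_simps scale_right_distrib
    scale_right_diff_distrib add_diff_add
  note coeff_simps = linear_simps table D_L D_I algebra_simps scale_left_distrib scale_left_diff_distrib

  \<comment> \<open>Each of the following identities is linear in every argument, hence follows from its
      instances for basis vectors, where it can be read off the multiplication table.\<close>
  have juxt_assoc: "juxt (juxt x y) z = juxt x (juxt y z)" for x y z
  proof (induction x rule: induct)
    case (left i)
    show ?case
    proof (induction y rule: induct)
      case (left j)
      show ?case by (induction z rule: induct) (simp_all add: linear_simps table ac_simps)
    next
      case (right j)
      show ?case by (induction z rule: induct) (simp_all add: linear_simps table ac_simps)
    qed (simp_all add: linear_simps)
  next
    case (right i)
    show ?case
    proof (induction y rule: induct)
      case (left j)
      show ?case by (induction z rule: induct) (simp_all add: linear_simps table ac_simps)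
    next
      case (right j)
      show ?case by (induction z rule: induct) (simp_all add: linear_simps table ac_simps)
    qed (simp_all add: linear_simps)
  qed (simp_all add: linear_simps)
  have leibniz: "D (juxt x y) = juxt (D x) y + juxt x (D y)" for x y
  proof (induction x rule: induct)
    case (left i)
    show ?case by (induction y rule: induct) (simp_all add: linear_simps, simp_all add: coeff_simps)
  next
    case (right i)
    show ?case by (induction y rule: induct) (simp_all add: linear_simps, simp_all add: coeff_simps)
  qed (simp_all add: linear_simps)
  have mul_eq: "mul x y = juxt w (juxt x y)" for x y
  proof (induction x rule: induct)
    case (left i)
    show ?case by (induction y rule: induct) (simp_all add: linear_simps table)
  next
    case (right i)
    show ?case by (induction y rule: induct) (simp_all add: linear_simps table)
  qed (simp_all add: linear_simps)
  have br_eq: "br x y = juxt (D x) y - juxt x (D y)" for x y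
  proof (induction x rule: induct)
    case (left i)
    show ?case by (induction y rule: induct) (simp_all add: linear_simps, simp_all add: coeff_simps)
  next
    case (right i)
    show ?case by (induction y rule: induct) (simp_all add: linear_simps, simp_all add: coeff_simps)
  qed (simp_all add: linear_simps)

  interpret J: differential_algebra scale juxt D
    by unfold_locales (fact assms(3) juxt_assoc juxt_comm D_simps leibniz)+
  have "mul = J.twisted w" "br = J.wronskian"
    by (intro ext mul_eq br_eq)+
  then show ?thesis
    using J.kantor_transposed_poisson by simp
qed

end
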